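(* Let $D$ be an integral domain which is not a field, with quotient field $K$. Let $\Omega\subseteq D$ be a subset and let $n\geq 1$ be an integer. Then $$\mathrm{Int}^{\{n-1\}}(\Omega,D)=\bigcap_{q\in\mathcal{P}_n(\Omega)}D(q).$$
   Context: For $f\in K[X]$ the divided differences are defined recursively by $\Phi^0(f)(X_0)=f(X_0)$ and, for $k\ge 1$, $$\Phi^k(f)(X_0,\ldots,X_k)=\frac{\Phi^{k-1}(f)(X_0,\ldots,X_{k-1})-\Phi^{k-1}(f)(X_0,\ldots,X_{k-2},X_k)}{X_{k-1}-X_k};$$ $\Phi^k(f)$ is a symmetric polynomial over $K$ in $k+1$ variables. For $m\ge 0$, $$\mathrm{Int}^{\{m\}}(\Omega,D)=\{f\in K[X] : \Phi^k(f)(\Omega^{k+1})\subset D\text{ for all }0\le k\le m\}.$$ $\mathcal{P}_n(\Omega)$ is the set of monic polynomials $q(X)\in D[X]$ of degree $n$ all of whose roots lie in $\Omega$ (so $q$ splits over $D$ as $q(X)=\prod_{i=1}^n(X-a_i)$ with $a_i\in\Omega$, repetitions allowed). For a monic non-constant $q\in D[X]$, $D(q)=D[X]+q(X)K[X]=\{r+q h : r\in D[X],\ h\in K[X]\}$. An intersection over an empty family is $K[X]$. *)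

theory Defs
  imports
    "HOL-Library.Poly_Mapping"
    "HOL-Library.FuncSet"
    "HOL-Computational_Algebra.Polynomial_Factorial"
begin

text \<open>Polynomials in the variables \<open>X\<^sub>0, X\<^sub>1, \<dots>\<close>: a finitely supported family of coefficients
  indexed by exponent vectors. With the product of \<open>Poly_Mapping\<close> this is the polynomial ring,
  an integral domain if the coefficient ring is one.\<close>

type_synonym 'a mpoly = "(nat \<Rightarrow>\<^sub>0 nat) \<Rightarrow>\<^sub>0 'a"

definition mvar :: "nat \<Rightarrow> 'a::comm_ring_1 mpoly" where
  "mvar i = Poly_Mapping.single (Poly_Mapping.single i 1) 1"

definition mconst :: "'a::comm_ring_1 \<Rightarrow> 'a mpoly" where
  "mconst c = Poly_Mapping.single 0 c"

text \<open>Evaluation at \<open>X\<^sub>i = x i\<close>, with coefficients sent to the target ring by \<open>\<phi>\<close>; it covers both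
  evaluation at points (\<open>\<phi> = id\<close>) and substitution of polynomials (\<open>\<phi> = mconst\<close>).\<close>

definition mon_eval :: "(nat \<Rightarrow> 'b::comm_ring_1) \<Rightarrow> (nat \<Rightarrow>\<^sub>0 nat) \<Rightarrow> 'b" where
  "mon_eval x m = (\<Prod>i\<in>Poly_Mapping.keys m. x i ^ Poly_Mapping.lookup m i)"

definition mpoly_eval ::
  "('a::comm_ring_1 \<Rightarrow> 'b::comm_ring_1) \<Rightarrow> (nat \<Rightarrow> 'b) \<Rightarrow> 'a mpoly \<Rightarrow> 'b" where
  "mpoly_eval \<phi> x p =
     (\<Sum>m\<in>Poly_Mapping.keys p. \<phi> (Poly_Mapping.lookup p m) * mon_eval x m)"

text \<open>\<open>move_var i j p\<close> is \<open>p\<close> with \<open>X\<^sub>i\<close> replaced by \<open>X\<^sub>j\<close>.\<close>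

definition move_var :: "nat \<Rightarrow> nat \<Rightarrow> 'a::comm_ring_1 mpoly \<Rightarrow> 'a mpoly" where
  "move_var i j = mpoly_eval mconst (mvar(i := mvar j))"

text \<open>The division in the recursion takes place in the polynomial ring. The quotient exists and is
  unique, so the description operator is well defined; see \<open>divdiff_Suc\<close> below.\<close>

primrec divdiff :: "nat \<Rightarrow> 'a::idom poly \<Rightarrow> 'a mpoly" where
  "divdiff 0 f = poly (map_poly mconst f) (mvar 0)"
| "divdiff (Suc k) f =
     (THE g. (mvar k - mvar (Suc k)) * g = divdiff k f - move_var k (Suc k) (divdiff k f))"

lemma mon_eval_superset:
  assumes "finite S" "Poly_Mapping.keys m \<subseteq> S"
  shows "mon_eval x m = (\<Prod>i\<in>S. x i ^ Poly_Mapping.lookup m i)"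
  unfolding mon_eval_def
  by (rule prod.mono_neutral_left) (use assms in \<open>auto simp: in_keys_iff\<close>)

lemma mon_eval_add: "mon_eval x (m + m') = mon_eval x m * mon_eval x m'"
proof -
  let ?S = "Poly_Mapping.keys m \<union> Poly_Mapping.keys m'"
  have "mon_eval x (m + m') = (\<Prod>i\<in>?S. x i ^ Poly_Mapping.lookup (m + m') i)"
    by (rule mon_eval_superset) (simp_all add: keys_add)
  also have "\<dots> = (\<Prod>i\<in>?S. x i ^ Poly_Mapping.lookup m i) * (\<Prod>i\<in>?S. x i ^ Poly_Mapping.lookup m' i)"
    by (simp add: lookup_add power_add prod.distrib)
  also have "\<dots> = mon_eval x m * mon_eval x m'"
    by (simp add: mon_eval_superset[of ?S m x] mon_eval_superset[of ?S m' x])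
  finally show ?thesis .
qed

lemma mon_eval_0 [simp]: "mon_eval x 0 = 1"
  by (simp add: mon_eval_def)

lemma mon_eval_single: "mon_eval x (Poly_Mapping.single i n) = x i ^ n"
  by (cases "n = 0") (simp_all add: mon_eval_def)

lemma mvar_power: "mvar i ^ n = Poly_Mapping.single (Poly_Mapping.single i n) (1 :: 'a::comm_ring_1)"
  by (induction n) (simp_all add: mvar_def mult_single single_add[symmetric] add.commute)

lemma mvar_eq_iff: "(mvar i :: 'a::comm_ring_1 mpoly) = mvar j \<longleftrightarrow> i = j"
proof
  assume eq: "(mvar i :: 'a mpoly) = mvar j"
  have "Poly_Mapping.keys (mvar i :: 'a mpoly) = Poly_Mapping.keys (mvar j :: 'a mpoly)"
    by (simp add: eq)
  then have "Poly_Mapping.single i (1::nat) = Poly_Mapping.single j 1"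
    by (simp add: mvar_def)
  then have "Poly_Mapping.keys (Poly_Mapping.single i (1::nat)) = Poly_Mapping.keys (Poly_Mapping.single j (1::nat))"
    by (rule arg_cong)
  then show "i = j" by simp
qed auto

lemma mpoly_monom_decomp:
  "Poly_Mapping.single m (c :: 'a::comm_ring_1) = mconst c * mon_eval mvar m"
proof -
  have prod: "(\<Prod>i\<in>S. Poly_Mapping.single (g i) (1::'a)) = Poly_Mapping.single (\<Sum>i\<in>S. g i) 1"
    if "finite S" for S :: "nat set" and g :: "nat \<Rightarrow> (nat \<Rightarrow>\<^sub>0 nat)"
    using that by induction (simp_all add: mult_single)
  have sum: "(\<Sum>i\<in>Poly_Mapping.keys m. Poly_Mapping.single i (Poly_Mapping.lookup m i)) = m"
  proof (rule poly_mapping_eqI)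
    fix j
    have "Poly_Mapping.lookup (\<Sum>i\<in>Poly_Mapping.keys m. Poly_Mapping.single i (Poly_Mapping.lookup m i)) j
        = (\<Sum>i\<in>Poly_Mapping.keys m. if i = j then Poly_Mapping.lookup m i else 0)"
      by (simp add: lookup_sum lookup_single when_def)
    also have "\<dots> = Poly_Mapping.lookup m j"
      by (simp add: in_keys_iff)
    finally show "Poly_Mapping.lookup (\<Sum>i\<in>Poly_Mapping.keys m. Poly_Mapping.single i (Poly_Mapping.lookup m i)) j
      = Poly_Mapping.lookup m j" .
  qed
  have "mon_eval mvar m = Poly_Mapping.single m (1::'a)"
    unfolding mon_eval_def mvar_power by (simp add: prod sum)
  then show ?thesis by (simp add: mconst_def mult_single)
qed

lemma mpoly_sum_monoms:
  "p = (\<Sum>m\<in>Poly_Mapping.keys p. mconst (Poly_Mapping.lookup p m) * mon_eval mvar m)"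
proof (rule poly_mapping_eqI)
  fix n
  have "Poly_Mapping.lookup (\<Sum>m\<in>Poly_Mapping.keys p. mconst (Poly_Mapping.lookup p m) * mon_eval mvar m) n
      = (\<Sum>m\<in>Poly_Mapping.keys p. if m = n then Poly_Mapping.lookup p m else 0)"
    by (simp add: lookup_sum lookup_single when_def mpoly_monom_decomp[symmetric])
  also have "\<dots> = Poly_Mapping.lookup p n"
    by (simp add: in_keys_iff)
  finally show "Poly_Mapping.lookup p n =
    Poly_Mapping.lookup (\<Sum>m\<in>Poly_Mapping.keys p. mconst (Poly_Mapping.lookup p m) * mon_eval mvar m) n"
    by simp
qed

lemma mvar_diff_dvd_mon:
  "(mvar i - mvar j) dvd (mon_eval mvar m - mon_eval (mvar(i := mvar j)) m :: 'a::comm_ring_1 mpoly)"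
proof -
  have dvd_prod: "d dvd (\<Prod>l\<in>S. u l) - (\<Prod>l\<in>S. v l)"
    if "finite S" "\<And>l. d dvd u l - v l" for S :: "nat set" and d :: "'a mpoly" and u v
    using that(1)
  proof induction
    case (insert l S)
    have "u l * prod u S - v l * prod v S = (u l - v l) * prod u S + v l * (prod u S - prod v S)"
      by (simp add: algebra_simps)
    then show ?case using insert that(2)[of l] by simp
  qed simp
  show ?thesis
    unfolding mon_eval_def
  proof (rule dvd_prod)
    fix l
    show "mvar i - mvar j dvd
      mvar l ^ Poly_Mapping.lookup m l - (mvar(i := mvar j)) l ^ Poly_Mapping.lookup m l"
      by (simp add: power_diff_sumr2)
  qed simp
qed

lemma mvar_diff_dvd: "(mvar i - mvar j) dvd (p - move_var i j p)"
proof -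
  have "p - move_var i j p = (\<Sum>m\<in>Poly_Mapping.keys p. mconst (Poly_Mapping.lookup p m) *
      (mon_eval mvar m - mon_eval (mvar(i := mvar j)) m))"
    by (subst (1) mpoly_sum_monoms[of p])
      (simp add: move_var_def mpoly_eval_def sum_subtractf right_diff_distrib)
  then show ?thesis
    by (simp add: dvd_sum mvar_diff_dvd_mon)
qed

lemma divdiff_Suc:
  "(mvar k - mvar (Suc k)) * divdiff (Suc k) f = divdiff k f - move_var k (Suc k) (divdiff k f)"
proof -
  have nz: "mvar k - mvar (Suc k) \<noteq> (0 :: 'a mpoly)"
    by (simp add: mvar_eq_iff)
  obtain g where "divdiff k f - move_var k (Suc k) (divdiff k f) = (mvar k - mvar (Suc k)) * g"
    using mvar_diff_dvd by (rule dvdE)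
  then have "\<exists>!g. (mvar k - mvar (Suc k)) * g = divdiff k f - move_var k (Suc k) (divdiff k f)"
    using nz by (metis mult_cancel_left)
  from theI'[OF this] show ?thesis by simp
qed

text \<open>Throughout, the domain \<open>D\<close> is the type \<open>'a\<close>, its quotient field \<open>K\<close> is \<open>'a fract\<close>, and \<open>D\<close>
  sits in \<open>K\<close> as the range of \<open>to_fract\<close>. The set \<open>\<Omega>\<^bsup>k+1\<^esup>\<close> is \<open>{..k} \<rightarrow>\<^sub>E \<Omega>\<close>; the values of
  \<open>a\<close> outside \<open>{..k}\<close> play no role, since \<open>divdiff k f\<close> involves \<open>X\<^sub>0, \<dots>, X\<^sub>k\<close> only.\<close>

definition Int_dd :: "nat \<Rightarrow> 'a::idom set \<Rightarrow> 'a fract poly set" where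
  "Int_dd m \<Omega> = {f. \<forall>k\<le>m.
     (\<lambda>a. mpoly_eval id (\<lambda>i. to_fract (a i)) (divdiff k f)) ` ({..k} \<rightarrow>\<^sub>E \<Omega>) \<subseteq> range to_fract}"

definition monic_split :: "nat \<Rightarrow> 'a::idom set \<Rightarrow> 'a poly set" where
  "monic_split n \<Omega> = {q. lead_coeff q = 1 \<and> degree q = n \<and>
     (\<exists>a. (\<forall>i<n. a i \<in> \<Omega>) \<and> q = (\<Prod>i<n. [:- a i, 1:]))}"

definition D_of :: "'a::idom poly \<Rightarrow> 'a fract poly set" where
  "D_of q = {fract_poly r + fract_poly q * h | r h. True}"

end

theory Submission
  imports Defs
begin

text \<open>
  The proof is Newton interpolation. Write \<open>f\<^sub>0 = f\<close> and let \<open>f\<^sub>k\<^sub>+\<^sub>1\<close> be the quotient of \<open>f\<^sub>k\<close> on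
  division by \<open>X - a\<^sub>k\<close>, so that \<open>f\<^sub>k = f\<^sub>k(a\<^sub>k) + (X - a\<^sub>k) f\<^sub>k\<^sub>+\<^sub>1\<close>. The argument rests on two facts.

  First, the value of \<open>\<Phi>\<^sup>k(f)\<close> at \<open>(a\<^sub>0, \<dots>, a\<^sub>k)\<close> is \<open>f\<^sub>k(a\<^sub>k)\<close>, also when some of the points coincide
  (\<open>mpoly_eval_divdiff\<close>). The recursion for \<open>\<Phi>\<^sup>k\<close> cannot be evaluated directly at coinciding
  points, so the successive divisions are carried out with the variables \<open>X\<^sub>0, X\<^sub>1, \<dots>\<close> in place of the
  points (\<open>divdiff_eq_iterated_division\<close>), where \<open>X\<^sub>k - X\<^sub>k\<^sub>+\<^sub>1\<close> can be cancelled. Division by a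
  monic linear polynomial commutes with ring homomorphisms, and this carries the formula to
  arbitrary points.

  Second, \<open>f\<close> lies in \<open>D((X - a) q)\<close> iff \<open>f(a) \<in> D\<close> and the quotient of \<open>f\<close> by \<open>X - a\<close> lies in
  \<open>D(q)\<close> (\<open>D_of_linear_times\<close>). Iterating, \<open>f\<close> lies in \<open>D((X - a\<^sub>0) \<cdots> (X - a\<^sub>n\<^sub>-\<^sub>1))\<close> iff
  \<open>f\<^sub>k(a\<^sub>k) \<in> D\<close> for all \<open>k < n\<close> (\<open>D_of_split\<close>).

  Together, \<open>f\<close> lies in all \<open>D(q)\<close> iff all divided differences of order below \<open>n\<close> take values in \<open>D\<close>
  on initial segments of sequences of length \<open>n\<close> in \<open>\<Omega>\<close>, and every tuple of length at most \<open>n\<close> is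
  such an initial segment.
\<close>

section \<open>Division by monic linear polynomials and ring homomorphisms\<close>

locale unital_ring_hom =
  fixes h :: "'a::comm_ring_1 \<Rightarrow> 'b::comm_ring_1"
  assumes hom_zero: "h 0 = 0"
    and hom_one: "h 1 = 1"
    and hom_add: "h (x + y) = h x + h y"
    and hom_mult: "h (x * y) = h x * h y"
begin

lemma hom_poly: "h (poly p c) = poly (map_poly h p) (h c)"
  by (induction p) (simp_all add: map_poly_pCons hom_zero hom_add hom_mult)

lemma hom_synthetic_div:
  "map_poly h (synthetic_div p c) = synthetic_div (map_poly h p) (h c)"
  by (induction p) (simp_all add: map_poly_pCons hom_zero hom_poly)

lemma hom_foldl_synthetic_div:
  "map_poly h (foldl synthetic_div p cs) = foldl synthetic_div (map_poly h p) (map h cs)"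
  by (induction cs arbitrary: p) (simp_all add: hom_synthetic_div)

end

lemma synthetic_div_uniqueI:
  fixes p :: "'a::comm_ring_1 poly"
  assumes "p = [:r:] + [:- c, 1:] * q"
  shows "synthetic_div p c = q"
proof -
  have "p + smult c q = pCons r q"
    by (simp add: assms)
  then show ?thesis
    using synthetic_div_unique by blast
qed

section \<open>Evaluation of multivariate polynomials\<close>

lemma unital_ring_hom_id: "unital_ring_hom id"
  by unfold_locales simp_all

lemma unital_ring_hom_mconst: "unital_ring_hom mconst"
  by unfold_locales (simp_all add: mconst_def single_add mult_single)

lemma unital_ring_hom_to_fract: "unital_ring_hom to_fract"
  by unfold_locales simp_all

context unital_ring_hom
begin

lemma mpoly_eval_superset:
  assumes "finite S" "Poly_Mapping.keys p \<subseteq> S"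
  shows "mpoly_eval h x p = (\<Sum>m\<in>S. h (Poly_Mapping.lookup p m) * mon_eval x m)"
  unfolding mpoly_eval_def
  by (rule sum.mono_neutral_left) (use assms in \<open>auto simp: in_keys_iff hom_zero\<close>)

lemma mpoly_eval_single: "mpoly_eval h x (Poly_Mapping.single m c) = h c * mon_eval x m"
  by (subst mpoly_eval_superset[of "{m}"]) simp_all

lemma mpoly_eval_add: "mpoly_eval h x (p + q) = mpoly_eval h x p + mpoly_eval h x q"
proof -
  let ?S = "Poly_Mapping.keys p \<union> Poly_Mapping.keys q"
  have S: "mpoly_eval h x r = (\<Sum>m\<in>?S. h (Poly_Mapping.lookup r m) * mon_eval x m)"
    if "Poly_Mapping.keys r \<subseteq> ?S" for r
    using that by (intro mpoly_eval_superset) simp_all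
  show ?thesis
    by (simp add: S Poly_Mapping.keys_add lookup_add hom_add distrib_right sum.distrib)
qed

lemma mpoly_eval_sum: "mpoly_eval h x (sum g S) = (\<Sum>i\<in>S. mpoly_eval h x (g i))"
  by (induction S rule: infinite_finite_induct) (simp_all add: mpoly_eval_add, simp_all add: mpoly_eval_def)

lemma mpoly_eval_mult: "mpoly_eval h x (p * q) = mpoly_eval h x p * mpoly_eval h x q"
proof -
  let ?mon = "\<lambda>r m. Poly_Mapping.single m (Poly_Mapping.lookup r m)"
  have decomp: "r = (\<Sum>m\<in>Poly_Mapping.keys r. ?mon r m)" for r :: "'a mpoly"
    using mpoly_sum_monoms[of r] by (simp add: mpoly_monom_decomp)
  have "p * q = (\<Sum>m\<in>Poly_Mapping.keys p. \<Sum>m'\<in>Poly_Mapping.keys q. ?mon p m * ?mon q m')"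
    by (subst (1) decomp[of p], subst (1) decomp[of q]) (simp add: sum_product)
  then have "mpoly_eval h x (p * q)
      = (\<Sum>m\<in>Poly_Mapping.keys p. \<Sum>m'\<in>Poly_Mapping.keys q.
          (h (Poly_Mapping.lookup p m) * mon_eval x m)
            * (h (Poly_Mapping.lookup q m') * mon_eval x m'))"
    by (simp add: mpoly_eval_sum mult_single mpoly_eval_single hom_mult mon_eval_add mult_ac)
  then show ?thesis
    by (simp add: mpoly_eval_def sum_product)
qed

lemma mpoly_eval_mconst: "mpoly_eval h x (mconst c) = h c"
  by (simp add: mconst_def mpoly_eval_single)

lemma mpoly_eval_mvar: "mpoly_eval h x (mvar i) = x i"
  by (simp add: mvar_def mpoly_eval_single mon_eval_single hom_one)

lemma unital_ring_hom_mpoly_eval: "unital_ring_hom (mpoly_eval h x)"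
proof
  show "mpoly_eval h x 0 = 0"
    by (simp add: mpoly_eval_def)
  show "mpoly_eval h x 1 = 1"
    using mpoly_eval_mconst[of x 1] by (simp add: mconst_def hom_one)
qed (rule mpoly_eval_add mpoly_eval_mult)+

text \<open>No difference of two points is inverted on either side, so the points may coincide. Taking
  the target to be the polynomial ring itself, this also shows which variables occur in the
  coefficients of the iterated quotient.\<close>

lemma mpoly_eval_iterated_division:
  "map_poly (mpoly_eval h x) (foldl synthetic_div (map_poly mconst f) (map mvar [0..<k]))
     = foldl synthetic_div (map_poly h f) (map x [0..<k])"
proof -
  interpret ev: unital_ring_hom "mpoly_eval h x"
    by (rule unital_ring_hom_mpoly_eval)
  have "map_poly (mpoly_eval h x) (map_poly mconst f) = map_poly h f"
    by (subst map_poly_map_poly) (simp_all add: ev.hom_zero o_def mpoly_eval_mconst mconst_def[of 0])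
  then show ?thesis
    by (simp add: ev.hom_foldl_synthetic_div o_def mpoly_eval_mvar)
qed

end

section \<open>Divided differences as Newton coefficients\<close>

text \<open>If \<open>F\<^sub>k\<close> is the iterated quotient, then \<open>F\<^sub>k(X\<^sub>k\<^sub>+\<^sub>1) - F\<^sub>k(X\<^sub>k) = (X\<^sub>k\<^sub>+\<^sub>1 - X\<^sub>k) F\<^sub>k\<^sub>+\<^sub>1(X\<^sub>k\<^sub>+\<^sub>1)\<close> by
  division with remainder. This is the recursion for divided differences, because the coefficients of
  \<open>F\<^sub>k\<close> involve only \<open>X\<^sub>0, \<dots>, X\<^sub>k\<^sub>-\<^sub>1\<close> and are therefore fixed when \<open>X\<^sub>k\<close> is replaced.\<close>

lemma divdiff_eq_iterated_division:
  "divdiff k f = poly (foldl synthetic_div (map_poly mconst f) (map mvar [0..<k])) (mvar k)"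
proof (induction k)
  case (Suc k)
  let ?F = "\<lambda>k. foldl synthetic_div (map_poly mconst f) (map mvar [0..<k])"
  interpret const: unital_ring_hom "mconst :: 'a \<Rightarrow> 'a mpoly"
    by (rule unital_ring_hom_mconst)
  interpret mv: unital_ring_hom "move_var k (Suc k) :: 'a mpoly \<Rightarrow> 'a mpoly"
    unfolding move_var_def by (rule const.unital_ring_hom_mpoly_eval)
  have fixed: "map_poly (move_var k (Suc k)) (?F k) = ?F k"
  proof -
    have "map (mvar(k := mvar (Suc k))) [0..<k] = (map mvar [0..<k] :: 'a mpoly list)"
      by simp
    then show ?thesis
      unfolding move_var_def const.mpoly_eval_iterated_division by metis
  qed
  have moved: "move_var k (Suc k) (divdiff k f) = poly (?F k) (mvar (Suc k))"
    by (simp add: Suc.IH mv.hom_poly fixed) (simp add: move_var_def const.mpoly_eval_mvar)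
  have "?F k = [:- mvar k, 1:] * ?F (Suc k) + [:poly (?F k) (mvar k):]"
    using synthetic_div_correct'[of "mvar k" "?F k"] by simp
  then have "poly (?F k) (mvar (Suc k))
      = poly ([:- mvar k, 1:] * ?F (Suc k) + [:poly (?F k) (mvar k):]) (mvar (Suc k))"
    by (rule arg_cong)
  then have "(mvar k - mvar (Suc k)) * poly (?F (Suc k)) (mvar (Suc k))
      = divdiff k f - move_var k (Suc k) (divdiff k f)"
    unfolding moved unfolding Suc.IH by (simp add: algebra_simps)
  also have "\<dots> = (mvar k - mvar (Suc k)) * divdiff (Suc k) f"
    by (rule divdiff_Suc[symmetric])
  finally show ?case
    by (simp add: mvar_eq_iff)
qed simp

lemma mpoly_eval_divdiff:
  "mpoly_eval id x (divdiff k f) = poly (foldl synthetic_div f (map x [0..<k])) (x k)"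
proof -
  interpret id: unital_ring_hom "id :: 'a \<Rightarrow> 'a"
    by (rule unital_ring_hom_id)
  interpret ev: unital_ring_hom "mpoly_eval id x"
    by (rule id.unital_ring_hom_mpoly_eval)
  show ?thesis
    by (simp add: divdiff_eq_iterated_division ev.hom_poly id.mpoly_eval_iterated_division
        id.mpoly_eval_mvar map_poly_id)
qed

lemma mpoly_eval_divdiff_cong:
  assumes "\<And>i. i \<le> k \<Longrightarrow> x i = y i"
  shows "mpoly_eval id x (divdiff k f) = mpoly_eval id y (divdiff k f)"
proof -
  have "map x [0..<k] = map y [0..<k]"
    using assms by simp
  then show ?thesis
    using assms[of k] by (simp only: mpoly_eval_divdiff order_refl)
qed

section \<open>Membership in the rings attached to split polynomials\<close>

lemma D_of_1: "D_of 1 = UNIV"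
proof -
  have "f = fract_poly 0 + fract_poly 1 * f" for f :: "'a fract poly"
    by simp
  then show ?thesis
    unfolding D_of_def by blast
qed

text \<open>If \<open>f = r + (X - a) q h\<close>, then \<open>f(a) = r(a)\<close>, and the quotient of \<open>f\<close> by \<open>X - a\<close> is that of \<open>r\<close>
  plus \<open>q h\<close>; dividing \<open>r\<close> by the monic \<open>X - a\<close> does not leave \<open>D[X]\<close>.\<close>

lemma D_of_linear_times:
  "f \<in> D_of ([:- a, 1:] * q) \<longleftrightarrow>
     poly f (to_fract a) \<in> range to_fract \<and> synthetic_div f (to_fract a) \<in> D_of q"
  (is "_ \<longleftrightarrow> ?val \<and> ?quot")
proof -
  interpret tf: unital_ring_hom "to_fract :: 'a \<Rightarrow> 'a fract"
    by (rule unital_ring_hom_to_fract)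
  have lin: "fract_poly ([:- a, 1:] * p) = [:- to_fract a, 1:] * fract_poly p" for p
    by (simp add: map_poly_pCons)
  show ?thesis
  proof
    assume "f \<in> D_of ([:- a, 1:] * q)"
    then obtain r h where f: "f = fract_poly r + [:- to_fract a, 1:] * fract_poly q * h"
      unfolding D_of_def lin by blast
    have "poly f (to_fract a) = to_fract (poly r a)"
      by (simp add: f tf.hom_poly)
    moreover have "synthetic_div f (to_fract a)
        = fract_poly (synthetic_div r a) + fract_poly q * h"
    proof (rule synthetic_div_uniqueI)
      have "fract_poly r = [:- to_fract a, 1:] * fract_poly (synthetic_div r a)
          + [:to_fract (poly r a):]"
        using synthetic_div_correct'[of "to_fract a" "fract_poly r"]
        by (simp only: tf.hom_synthetic_div tf.hom_poly)
      then show "f = [:to_fract (poly r a):]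
          + [:- to_fract a, 1:] * (fract_poly (synthetic_div r a) + fract_poly q * h)"
        unfolding f by (simp only: algebra_simps)
    qed
    ultimately show "?val \<and> ?quot"
      unfolding D_of_def by auto
  next
    assume "?val \<and> ?quot"
    then obtain c r h where c: "poly f (to_fract a) = to_fract c"
      and quot: "synthetic_div f (to_fract a) = fract_poly r + fract_poly q * h"
      unfolding D_of_def by auto
    have "f = [:- to_fract a, 1:] * (fract_poly r + fract_poly q * h) + [:to_fract c:]"
      using synthetic_div_correct'[of "to_fract a" f] by (simp only: c quot)
    also have "\<dots> = fract_poly ([:- a, 1:] * r + [:c:]) + fract_poly ([:- a, 1:] * q) * h"
      unfolding lin fract_poly_add by (simp add: map_poly_pCons algebra_simps)
    finally show "f \<in> D_of ([:- a, 1:] * q)"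
      unfolding D_of_def by blast
  qed
qed

lemma D_of_split_list:
  "f \<in> D_of (\<Prod>a\<leftarrow>as. [:- a, 1:]) \<longleftrightarrow>
     (\<forall>k<length as. poly (foldl synthetic_div f (map to_fract (take k as))) (to_fract (as ! k))
        \<in> range to_fract)"
proof (induction as arbitrary: f)
  case (Cons a as)
  show ?case
    by (simp only: list.map prod_list.Cons D_of_linear_times Cons.IH length_Cons All_less_Suc2)
      simp
qed (simp add: D_of_1)

lemma D_of_split:
  "f \<in> D_of (\<Prod>i<n. [:- a i, 1:]) \<longleftrightarrow>
     (\<forall>k<n. mpoly_eval id (\<lambda>i. to_fract (a i)) (divdiff k f) \<in> range to_fract)"
proof -
  have as_list: "(\<Prod>i<n. [:- a i, 1:]) = (\<Prod>b\<leftarrow>map a [0..<n]. [:- b, 1:])"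
    by (simp add: prod.list_conv_set_nth atLeast0LessThan)
  show ?thesis
    unfolding as_list D_of_split_list mpoly_eval_divdiff by (simp add: take_map o_def)
qed

lemma monic_split_eq:
  "monic_split n \<Omega> = {\<Prod>i<n. [:- a i, 1:] | a. \<forall>i<n. a i \<in> \<Omega>}"
proof -
  have "lead_coeff (\<Prod>i<n. [:- a i, 1:]) = 1" for a :: "nat \<Rightarrow> 'a"
    by (simp add: lead_coeff_prod)
  moreover have "degree (\<Prod>i<n. [:- a i, 1:]) = n" for a :: "nat \<Rightarrow> 'a"
    by (simp add: degree_prod_eq_sum_degree)
  ultimately show ?thesis
    unfolding monic_split_def by blast
qed

theorem theorem2p9:
  fixes \<Omega> :: "'a::idom set" and n :: nat
  assumes not_field: "\<exists>d::'a. d \<noteq> 0 \<and> \<not> d dvd 1"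
    and n: "n \<ge> 1"
  shows "Int_dd (n - 1) \<Omega> = (\<Inter>q\<in>monic_split n \<Omega>. D_of q)"
proof -
  define val where "val k f a = mpoly_eval id (\<lambda>i. to_fract (a i)) (divdiff k f)"
    for k and f :: "'a fract poly" and a :: "nat \<Rightarrow> 'a"
  have cong: "val k f a = val k f b" if "\<And>i. i \<le> k \<Longrightarrow> a i = b i" for k f a b
    unfolding val_def using that by (intro mpoly_eval_divdiff_cong) simp
  have segments: "(\<forall>a\<in>{..k} \<rightarrow>\<^sub>E \<Omega>. val k f a \<in> range to_fract) \<longleftrightarrow>
      (\<forall>a. (\<forall>i<n. a i \<in> \<Omega>) \<longrightarrow> val k f a \<in> range to_fract)" (is "?L \<longleftrightarrow> ?R")
    if "k < n" for k f
  proof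
    assume L: ?L
    show ?R
    proof (intro allI impI)
      fix a assume "\<forall>i<n. a i \<in> \<Omega>"
      then have "restrict a {..k} \<in> {..k} \<rightarrow>\<^sub>E \<Omega>"
        using \<open>k < n\<close> by auto
      moreover have "val k f a = val k f (restrict a {..k})"
        by (rule cong) simp
      ultimately show "val k f a \<in> range to_fract"
        using L by simp
    qed
  next
    assume R: ?R
    show ?L
    proof
      fix a assume a: "a \<in> {..k} \<rightarrow>\<^sub>E \<Omega>"
      \<comment> \<open>A tuple is prolonged to length \<open>n\<close> by repeating its first entry.\<close>
      define b where "b i = (if i \<le> k then a i else a 0)" for i
      have "\<forall>i<n. b i \<in> \<Omega>"
        using a by (auto simp: b_def)
      moreover have "val k f a = val k f b"
        by (rule cong) (simp add: b_def)
      ultimately show "val k f a \<in> range to_fract"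
        using R by simp
    qed
  qed
  have "f \<in> Int_dd (n - 1) \<Omega> \<longleftrightarrow> f \<in> (\<Inter>q\<in>monic_split n \<Omega>. D_of q)" for f
  proof -
    have "k \<le> n - 1 \<longleftrightarrow> k < n" for k
      using n by auto
    then have "f \<in> Int_dd (n - 1) \<Omega> \<longleftrightarrow>
        (\<forall>k<n. \<forall>a\<in>{..k} \<rightarrow>\<^sub>E \<Omega>. val k f a \<in> range to_fract)"
      by (simp add: Int_dd_def val_def image_subset_iff)
    also have "\<dots> \<longleftrightarrow> (\<forall>a. (\<forall>i<n. a i \<in> \<Omega>) \<longrightarrow> (\<forall>k<n. val k f a \<in> range to_fract))"
      using segments by blast
    also have "\<dots> \<longleftrightarrow> (\<forall>a. (\<forall>i<n. a i \<in> \<Omega>) \<longrightarrow> f \<in> D_of (\<Prod>i<n. [:- a i, 1:]))"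
      by (simp only: D_of_split val_def)
    also have "\<dots> \<longleftrightarrow> f \<in> (\<Inter>q\<in>monic_split n \<Omega>. D_of q)"
      unfolding monic_split_eq by blast
    finally show ?thesis .
  qed
  then show ?thesis
    by blast
qed

end
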